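(* Let $m$ be a positive integer and let $A_0=I_m, A_1, A_2$ be the adjacency matrices of a non-symmetric association scheme of class $2$ on $m$ points (so $A_2=A_1^\top$). Let $\mathbf{1}$ denote the all-one row vector of length $m$, and define the $2(m+1)\times 2(m+1)$ matrices, written in block form with respect to a partition of the index set into consecutive blocks of sizes $1,m,m,1$: \[ C_0=I_{2(m+1)},\qquad C_1=\begin{bmatrix} 0&\mathbf{1}&0&0 \\ 0&A_1&A_2&\mathbf{1}^\top \\ \mathbf{1}^\top&A_2&A_1&0 \\ 0&0&\mathbf{1}&0 \end{bmatrix},\qquad C_2=C_1^\top,\qquad C_3=J-C_0-C_1-C_2, \] where $J$ is the all-one matrix. Then $\{C_0,C_1,C_2,C_3\}$ is the set of adjacency matrices of an association scheme of class $3$ on $2(m+1)$ points (called the extended double cover), and its first eigenmatrix is \[ \begin{bmatrix} 1&m&m&1 \\ 1&\sqrt{-m}&-\sqrt{-m}&-1 \\ 1&-\sqrt{-m}&\sqrt{-m} &-1\\ 1&-1&-1&1 \end{bmatrix} \] (for a suitable ordering of the primitive idempotents), where $\sqrt{-m}=i\sqrt{m}$.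
   Context: A (commutative) association scheme of class $d$ on a finite set $X$ with $|X|=n$ is given by $0/1$ matrices $A_0=I_n,A_1,\dots,A_d$ (adjacency matrices) with $\sum_{i} A_i=J$, the set $\{A_i\}$ closed under transposition, and the linear span $\mathcal{A}=\langle A_0,\dots,A_d\rangle$ (the Bose--Mesner algebra) closed under matrix multiplication and commutative. It is non-symmetric if some $A_i$ is not symmetric. $\mathcal{A}$ has a basis of primitive idempotents $E_0=\frac1n J,E_1,\dots,E_d$, and the first eigenmatrix $P=(P_{i,j})_{0\le i,j\le d}$ is defined by $A_j=\sum_{i} P_{i,j}E_i$, i.e. $(A_0,\dots,A_d)=(E_0,\dots,E_d)P$. *)

theory Defs
  imports Complex_Main "Jordan_Normal_Form.VS_Connect"
begin

text \<open>
  The point set of a scheme is \<open>{0..<n}\<close>, so that its adjacency matrices are complex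
  \<open>n \<times> n\<close> matrices; relations and idempotents are indexed by \<open>{..d}\<close>.
\<close>

abbreviation mat_space :: "nat \<Rightarrow> (complex, complex mat) module" where
  "mat_space n \<equiv> module_mat TYPE(complex) n n"

definition all_ones :: "nat \<Rightarrow> nat \<Rightarrow> complex mat" where
  "all_ones nr nc = mat nr nc (\<lambda>_. 1)"

definition bose_mesner :: "nat \<Rightarrow> nat \<Rightarrow> (nat \<Rightarrow> complex mat) \<Rightarrow> complex mat set" where
  "bose_mesner n d A = LinearCombinations.module.span class_ring (mat_space n) (A ` {..d})"

text \<open>
  Non-emptiness of every relation (\<open>A i \<noteq> 0\<close>) is what makes the number of classes of the
  scheme, and hence the dimension \<open>d + 1\<close> of its Bose--Mesner algebra, well defined.
\<close>

definition association_scheme :: "nat \<Rightarrow> nat \<Rightarrow> (nat \<Rightarrow> complex mat) \<Rightarrow> bool" where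
  "association_scheme n d A \<longleftrightarrow>
     (\<forall>i\<le>d. A i \<in> carrier_mat n n \<and> elements_mat (A i) \<subseteq> {0, 1} \<and> A i \<noteq> 0\<^sub>m n n) \<and>
     A 0 = 1\<^sub>m n \<and>
     (\<Oplus>\<^bsub>mat_space n\<^esub> i\<in>{..d}. A i) = all_ones n n \<and>
     (\<forall>i\<le>d. transpose_mat (A i) \<in> A ` {..d}) \<and>
     (\<forall>M\<in>bose_mesner n d A. \<forall>N\<in>bose_mesner n d A. M * N \<in> bose_mesner n d A) \<and>
     (\<forall>M\<in>bose_mesner n d A. \<forall>N\<in>bose_mesner n d A. M * N = N * M)"

definition nonsymmetric_scheme :: "nat \<Rightarrow> (nat \<Rightarrow> complex mat) \<Rightarrow> bool" where
  "nonsymmetric_scheme d A \<longleftrightarrow> (\<exists>i\<le>d. transpose_mat (A i) \<noteq> A i)"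

definition primitive_idempotent :: "nat \<Rightarrow> complex mat set \<Rightarrow> complex mat \<Rightarrow> bool" where
  "primitive_idempotent n B M \<longleftrightarrow>
     M \<in> B \<and> M * M = M \<and> M \<noteq> 0\<^sub>m n n \<and>
     \<not> (\<exists>F\<in>B. \<exists>G\<in>B. F * F = F \<and> G * G = G \<and> F \<noteq> 0\<^sub>m n n \<and> G \<noteq> 0\<^sub>m n n \<and>
          F * G = 0\<^sub>m n n \<and> G * F = 0\<^sub>m n n \<and> M = F + G)"

text \<open>
  An ordering \<open>E 0 = J / n, E 1, \<dots>, E d\<close> of the primitive idempotents forming a basis of the
  Bose--Mesner algebra.  Linear independence is a property of the set \<open>E ` {..d}\<close>, so
  injectivity of the enumeration is required separately.
\<close>

definition idempotent_basis ::
  "nat \<Rightarrow> nat \<Rightarrow> (nat \<Rightarrow> complex mat) \<Rightarrow> (nat \<Rightarrow> complex mat) \<Rightarrow> bool" where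
  "idempotent_basis n d A E \<longleftrightarrow>
     E 0 = (1 / of_nat n) \<cdot>\<^sub>m all_ones n n \<and>
     (\<forall>i\<le>d. primitive_idempotent n (bose_mesner n d A) (E i)) \<and>
     inj_on E {..d} \<and>
     \<not> LinearCombinations.module.lin_dep class_ring (mat_space n) (E ` {..d}) \<and>
     LinearCombinations.module.span class_ring (mat_space n) (E ` {..d}) = bose_mesner n d A"

definition first_eigenmatrix ::
  "nat \<Rightarrow> nat \<Rightarrow> (nat \<Rightarrow> complex mat) \<Rightarrow> (nat \<Rightarrow> complex mat) \<Rightarrow> complex mat \<Rightarrow> bool" where
  "first_eigenmatrix n d A E P \<longleftrightarrow>
     P \<in> carrier_mat (d + 1) (d + 1) \<and>
     (\<forall>j\<le>d. A j = (\<Oplus>\<^bsub>mat_space n\<^esub> i\<in>{..d}. P $$ (i, j) \<cdot>\<^sub>m E i))"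

text \<open>
  The inner \<open>four_block_mat\<close> calls are the four quadrants of the \<open>4 \<times> 4\<close> block matrix with
  block sizes \<open>1, m, m, 1\<close>:
  rows \<open>[0, 1, 0, 0]\<close>, \<open>[0, A1, A2, 1\<^sup>T]\<close>, \<open>[1\<^sup>T, A2, A1, 0]\<close>, \<open>[0, 0, 1, 0]\<close>.
\<close>

definition double_cover_mat :: "nat \<Rightarrow> complex mat \<Rightarrow> complex mat \<Rightarrow> complex mat" where
  "double_cover_mat m A1 A2 =
     four_block_mat
       (four_block_mat (0\<^sub>m 1 1) (all_ones 1 m)
                       (0\<^sub>m m 1) A1)
       (four_block_mat (0\<^sub>m 1 m) (0\<^sub>m 1 1)
                       A2        (all_ones m 1))
       (four_block_mat (all_ones m 1) A2
                       (0\<^sub>m 1 1)      (0\<^sub>m 1 m))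
       (four_block_mat A1             (0\<^sub>m m 1)
                       (all_ones 1 m) (0\<^sub>m 1 1))"

definition extended_double_cover :: "nat \<Rightarrow> (nat \<Rightarrow> complex mat) \<Rightarrow> nat \<Rightarrow> complex mat" where
  "extended_double_cover m A =
     (let n = 2 * (m + 1);
          C0 = 1\<^sub>m n;
          C1 = double_cover_mat m (A 1) (A 2);
          C2 = transpose_mat C1;
          C3 = all_ones n n - C0 - C1 - C2
      in (!) [C0, C1, C2, C3])"

end

theory Submission
  imports Defs
begin

text \<open>
  A non-symmetric class 2 scheme is a doubly regular tournament: with \<open>k = (m - 1) / 2\<close>, the matrix
  \<open>A\<^sub>1\<close> has constant row and column sums \<open>k\<close>, and \<open>A\<^sub>1 A\<^sub>1\<^sup>T = A\<^sub>1\<^sup>T A\<^sub>1 = k I + ((k - 1) / 2) (J - I)\<close>.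
  On the double cover, \<open>C\<^sub>3\<close> is the permutation matrix of the fixed-point-free involution swapping the
  two points of each antipodal pair; it satisfies \<open>C\<^sub>1 C\<^sub>3 = C\<^sub>3 C\<^sub>1 = C\<^sub>2\<close>, and tournament regularity gives
  \<open>C\<^sub>1 C\<^sub>2 = m I + k (C\<^sub>1 + C\<^sub>2)\<close>.  These relations determine the whole multiplication table.
  Inverting the claimed eigenmatrix yields candidates for the idempotents as explicit combinations of the
  \<open>C\<^sub>i\<close>; the table shows that they are orthogonal idempotents, and orthogonal nonzero
  idempotents spanning an algebra make it commutative and are automatically its primitive ones.
\<close>

section \<open>Linear combinations of matrices and orthogonal idempotents\<close>

text \<open>The combination is defined entrywise, so that identities between combinations become
  identities between sums of complex numbers. Coefficients belong to indices rather than to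
  matrices, so repeated matrices in the family cause no ambiguity.\<close>

definition mat_comb :: "nat \<Rightarrow> nat \<Rightarrow> (nat \<Rightarrow> complex) \<Rightarrow> (nat \<Rightarrow> complex mat) \<Rightarrow> complex mat" where
  "mat_comb n d a X = mat n n (\<lambda>(i, j). \<Sum>p\<le>d. a p * X p $$ (i, j))"

lemma mat_comb_carrier [simp]: "mat_comb n d a X \<in> carrier_mat n n"
  by (simp add: mat_comb_def)

lemma mat_comb_dim [simp]: "dim_row (mat_comb n d a X) = n" "dim_col (mat_comb n d a X) = n"
  by (simp_all add: mat_comb_def)

lemma mat_comb_index [simp]:
  "i < n \<Longrightarrow> j < n \<Longrightarrow> mat_comb n d a X $$ (i, j) = (\<Sum>p\<le>d. a p * X p $$ (i, j))"
  by (simp add: mat_comb_def)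

lemma mat_comb_cong:
  "(\<And>p. p \<le> d \<Longrightarrow> a p = b p) \<Longrightarrow> (\<And>p. p \<le> d \<Longrightarrow> X p = Y p) \<Longrightarrow> mat_comb n d a X = mat_comb n d b Y"
  by (intro eq_matI) simp_all

lemma mat_comb_single:
  assumes "p \<le> d" and "X p \<in> carrier_mat n n"
  shows "mat_comb n d (\<lambda>q. if q = p then 1 else 0) X = X p"
proof (rule eq_matI)
  fix i j assume "i < dim_row (X p)" "j < dim_col (X p)"
  then have ij: "i < n" "j < n" using assms(2) by auto
  have "(\<Sum>q\<le>d. (if q = p then 1 else 0) * X q $$ (i, j)) = (\<Sum>q\<le>d. if q = p then X q $$ (i, j) else 0)"
    by (rule sum.cong) auto
  with ij show "mat_comb n d (\<lambda>q. if q = p then 1 else 0) X $$ (i, j) = X p $$ (i, j)"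
    using assms(1) by simp
qed (use assms in auto)

lemma finsum_mat_space:
  assumes "finite F" and "\<And>p. p \<in> F \<Longrightarrow> X p \<in> carrier_mat n n"
  shows "(\<Oplus>\<^bsub>mat_space n\<^esub> p\<in>F. X p) = mat n n (\<lambda>(i, j). \<Sum>p\<in>F. X p $$ (i, j))"
proof -
  interpret abelian_group "mat_space n" by (rule abelian_group_mat)
  show ?thesis
    using assms
  proof (induction F rule: finite_induct)
    case empty
    show ?case by (auto simp: matrix_vs_simps intro!: eq_matI)
  next
    case (insert p F)
    have "(\<Oplus>\<^bsub>mat_space n\<^esub> q\<in>insert p F. X q) = X p + (\<Oplus>\<^bsub>mat_space n\<^esub> q\<in>F. X q)"
      using insert by (subst finsum_insert) (auto simp: matrix_vs_simps)
    also have "\<dots> = mat n n (\<lambda>(i, j). \<Sum>q\<in>insert p F. X q $$ (i, j))"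
      using insert by (intro eq_matI) auto
    finally show ?case .
  qed
qed

lemma mat_comb_eq_finsum:
  assumes "\<And>p. p \<le> d \<Longrightarrow> X p \<in> carrier_mat n n"
  shows "(\<Oplus>\<^bsub>mat_space n\<^esub> p\<in>{..d}. a p \<cdot>\<^sub>m X p) = mat_comb n d a X"
proof -
  have X: "dim_row (X p) = n" "dim_col (X p) = n" if "p \<le> d" for p
    using assms[OF that] by auto
  show ?thesis
    by (subst finsum_mat_space) (auto simp: X assms intro!: eq_matI sum.cong)
qed

text \<open>Change of basis: substituting one family of combinations into another multiplies the
  coefficient row \<open>a\<close> by the matrix \<open>Q\<close>. It serves to pass between
  adjacency matrices and idempotents.\<close>

lemma mat_comb_mat_comb:
  "mat_comb n d a (\<lambda>p. mat_comb n d (Q p) X) = mat_comb n d (\<lambda>q. \<Sum>p\<le>d. a p * Q p q) X"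
proof (rule eq_matI)
  fix i j assume "i < dim_row (mat_comb n d (\<lambda>q. \<Sum>p\<le>d. a p * Q p q) X)"
    and "j < dim_col (mat_comb n d (\<lambda>q. \<Sum>p\<le>d. a p * Q p q) X)"
  then have "i < n" "j < n" by auto
  then show "mat_comb n d a (\<lambda>p. mat_comb n d (Q p) X) $$ (i, j) =
      mat_comb n d (\<lambda>q. \<Sum>p\<le>d. a p * Q p q) X $$ (i, j)"
    by (simp add: sum_distrib_left sum_distrib_right mult.assoc) (rule sum.swap)
qed auto

text \<open>The combinations form a submodule containing every \<open>X p\<close>, which bounds the
  span from above. Conversely the span is closed under scaling and finite sums, by induction over
  the index set.\<close>

lemma span_image_eq_mat_comb:
  assumes "\<And>p. p \<le> d \<Longrightarrow> X p \<in> carrier_mat n n"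
  shows "LinearCombinations.module.span class_ring (mat_space n) (X ` {..d})
    = range (\<lambda>a. mat_comb n d a X)"
proof -
  interpret V: vectorspace "class_ring :: complex ring" "mat_space n" by (rule matrix_vs)
  have sub: "X ` {..d} \<subseteq> carrier (mat_space n)" using assms by (auto simp: matrix_vs_simps)
  show ?thesis
  proof (intro equalityI V.span_is_subset)
    show "X ` {..d} \<subseteq> range (\<lambda>a. mat_comb n d a X)"
      using mat_comb_single assms by (metis (no_types, lifting) atMost_iff image_subset_iff rangeI)
    show "submodule class_ring (range (\<lambda>a. mat_comb n d a X)) (mat_space n)"
    proof
      show "range (\<lambda>a. mat_comb n d a X) \<subseteq> carrier (mat_space n)"
        by (auto simp: matrix_vs_simps)
      have "mat_comb n d a X + mat_comb n d b X = mat_comb n d (\<lambda>p. a p + b p) X" for a b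
        by (rule eq_matI) (auto simp: sum.distrib algebra_simps)
      then show "v \<oplus>\<^bsub>mat_space n\<^esub> w \<in> range (\<lambda>a. mat_comb n d a X)"
        if "v \<in> range (\<lambda>a. mat_comb n d a X)" "w \<in> range (\<lambda>a. mat_comb n d a X)" for v w
        using that by (auto simp: matrix_vs_simps)
      have "0\<^sub>m n n = mat_comb n d (\<lambda>p. 0) X"
        by (rule eq_matI) auto
      then show "\<zero>\<^bsub>mat_space n\<^esub> \<in> range (\<lambda>a. mat_comb n d a X)"
        by (auto simp: matrix_vs_simps)
      have "c \<cdot>\<^sub>m mat_comb n d a X = mat_comb n d (\<lambda>p. c * a p) X" for c a
        by (rule eq_matI) (auto simp: sum_distrib_left mult.assoc)
      then show "c \<odot>\<^bsub>mat_space n\<^esub> v \<in> range (\<lambda>a. mat_comb n d a X)"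
        if "v \<in> range (\<lambda>a. mat_comb n d a X)" for c v
        using that by (auto simp: matrix_vs_simps)
    qed
  next
    interpret S: submodule class_ring
      "LinearCombinations.module.span class_ring (mat_space n) (X ` {..d})" "mat_space n"
      by (rule V.span_is_submodule[OF sub])
    have X: "X p \<in> LinearCombinations.module.span class_ring (mat_space n) (X ` {..d})" if "p \<le> d" for p
      using V.in_own_span[OF sub] that by auto
    have "(\<Oplus>\<^bsub>mat_space n\<^esub> p\<in>F. a p \<cdot>\<^sub>m X p)
        \<in> LinearCombinations.module.span class_ring (mat_space n) (X ` {..d})"
      if "finite F" "F \<subseteq> {..d}" for a F
      using that
    proof (induction F rule: finite_induct)
      case empty
      then show ?case by simp
    next
      case (insert p F)
      have "(\<Oplus>\<^bsub>mat_space n\<^esub> q\<in>insert p F. a q \<cdot>\<^sub>m X q)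
          = a p \<cdot>\<^sub>m X p \<oplus>\<^bsub>mat_space n\<^esub> (\<Oplus>\<^bsub>mat_space n\<^esub> q\<in>F. a q \<cdot>\<^sub>m X q)"
        using insert assms by (intro V.finsum_insert) (auto simp: matrix_vs_simps subset_iff)
      moreover have "a p \<cdot>\<^sub>m X p \<in> LinearCombinations.module.span class_ring (mat_space n) (X ` {..d})"
        using S.smult_closed[of "a p" "X p"] X insert.prems by (auto simp: matrix_vs_simps)
      ultimately show ?case using insert S.m_closed by auto
    qed
    from this[of "{..d}"]
    show "range (\<lambda>a. mat_comb n d a X)
        \<subseteq> LinearCombinations.module.span class_ring (mat_space n) (X ` {..d})"
      using mat_comb_eq_finsum[of d X n, OF assms] by auto
  qed
qed

lemma mat_comb_mult_index:
  assumes "\<And>p. p \<le> d \<Longrightarrow> X p \<in> carrier_mat n n" "i < n" "j < n"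
  shows "(mat_comb n d a X * mat_comb n d b X) $$ (i, j)
    = (\<Sum>p\<le>d. \<Sum>q\<le>d. a p * b q * (X p * X q) $$ (i, j))"
proof -
  have X: "dim_row (X p) = n" "dim_col (X p) = n" if "p \<le> d" for p
    using assms(1)[OF that] by auto
  have "(mat_comb n d a X * mat_comb n d b X) $$ (i, j)
      = (\<Sum>l<n. (\<Sum>p\<le>d. a p * X p $$ (i, l)) * (\<Sum>q\<le>d. b q * X q $$ (l, j)))"
    using assms by (simp add: scalar_prod_def lessThan_atLeast0)
  also have "\<dots> = (\<Sum>l<n. \<Sum>p\<le>d. \<Sum>q\<le>d. a p * b q * (X p $$ (i, l) * X q $$ (l, j)))"
    by (simp add: sum_product mult_ac)
  also have "\<dots> = (\<Sum>p\<le>d. \<Sum>q\<le>d. \<Sum>l<n. a p * b q * (X p $$ (i, l) * X q $$ (l, j)))"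
    by (subst sum.swap, rule sum.cong[OF refl], rule sum.swap)
  also have "\<dots> = (\<Sum>p\<le>d. \<Sum>q\<le>d. a p * b q * (X p * X q) $$ (i, j))"
    using assms(2,3) by (intro sum.cong refl) (simp add: X scalar_prod_def lessThan_atLeast0 sum_distrib_left)
  finally show ?thesis .
qed

section \<open>Algebras spanned by orthogonal nonzero idempotents\<close>

locale orthogonal_idempotents =
  fixes n d :: nat and E :: "nat \<Rightarrow> complex mat"
  assumes carrier: "p \<le> d \<Longrightarrow> E p \<in> carrier_mat n n"
    and orthogonal: "p \<le> d \<Longrightarrow> q \<le> d \<Longrightarrow> E p * E q = (if p = q then E p else 0\<^sub>m n n)"
    and nonzero: "p \<le> d \<Longrightarrow> E p \<noteq> 0\<^sub>m n n"
begin

lemma mat_comb_mult: "mat_comb n d a E * mat_comb n d b E = mat_comb n d (\<lambda>p. a p * b p) E"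
proof (rule eq_matI)
  fix i j assume "i < dim_row (mat_comb n d (\<lambda>p. a p * b p) E)"
    "j < dim_col (mat_comb n d (\<lambda>p. a p * b p) E)"
  then have ij: "i < n" "j < n" by auto
  have "(\<Sum>q\<le>d. a p * b q * (E p * E q) $$ (i, j)) = a p * b p * E p $$ (i, j)" if "p \<le> d" for p
  proof -
    have "(\<Sum>q\<le>d. a p * b q * (E p * E q) $$ (i, j))
        = (\<Sum>q\<le>d. if q = p then a p * b p * E p $$ (i, j) else 0)"
      using that ij by (intro sum.cong) (auto simp: orthogonal)
    with that show ?thesis by simp
  qed
  with ij show "(mat_comb n d a E * mat_comb n d b E) $$ (i, j) = mat_comb n d (\<lambda>p. a p * b p) E $$ (i, j)"
    by (simp add: mat_comb_mult_index[OF carrier] del: index_mult_mat)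
qed auto

text \<open>Multiplication by \<open>E p\<close> isolates the coefficient at \<open>p\<close>.
  Linear independence and primitivity both rest on this.\<close>

lemma mat_comb_mult_idempotent:
  assumes "p \<le> d"
  shows "mat_comb n d a E * E p = a p \<cdot>\<^sub>m E p"
proof -
  have "mat_comb n d a E * mat_comb n d (\<lambda>q. if q = p then 1 else 0) E
      = mat_comb n d (\<lambda>q. a q * (if q = p then 1 else 0)) E"
    by (rule mat_comb_mult)
  also have "\<dots> = mat_comb n d (\<lambda>q. a p * (if q = p then 1 else 0)) E"
    by (rule mat_comb_cong) auto
  also have "\<dots> = a p \<cdot>\<^sub>m mat_comb n d (\<lambda>q. if q = p then 1 else 0) E"
    by (rule eq_matI) (auto simp: sum_distrib_left mult.assoc)
  finally show ?thesis
    using mat_comb_single[where X = E, OF assms carrier[OF assms]] by simp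
qed

lemma smult_eq_zero:
  assumes "p \<le> d" "c \<cdot>\<^sub>m E p = 0\<^sub>m n n"
  shows "c = 0"
proof (rule ccontr)
  assume "c \<noteq> 0"
  have "E p $$ (i, j) = 0" if "i < n" "j < n" for i j
    using arg_cong[OF assms(2), of "\<lambda>M. M $$ (i, j)"] \<open>c \<noteq> 0\<close> carrier[OF assms(1)] that by auto
  then have "E p = 0\<^sub>m n n"
    using carrier[OF assms(1)] by (intro eq_matI) auto
  with nonzero[OF assms(1)] show False by simp
qed

lemma inj_on_idempotents: "inj_on E {..d}"
proof (rule inj_onI, rule ccontr)
  fix p q assume "p \<in> {..d}" "q \<in> {..d}" "E p = E q" "p \<noteq> q"
  then have "E p = 0\<^sub>m n n"
    using orthogonal[of p p] orthogonal[of p q] by simp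
  with \<open>p \<in> {..d}\<close> nonzero show False by simp
qed

text \<open>Multiplying a vanishing combination by \<open>E p\<close> leaves its coefficient at
  \<open>p\<close> times \<open>E p\<close>, so that coefficient is zero. Injectivity of
  \<open>E\<close> turns the library's coefficients, which are attached to matrices, into
  coefficients attached to indices.\<close>

lemma lin_indpt_idempotents:
  "\<not> LinearCombinations.module.lin_dep class_ring (mat_space n) (E ` {..d})"
proof -
  interpret V: vectorspace "class_ring :: complex ring" "mat_space n" by (rule matrix_vs)
  show ?thesis
  proof (rule V.finite_lin_indpt2)
    fix a :: "complex mat \<Rightarrow> complex"
    assume "V.lincomb a (E ` {..d}) = \<zero>\<^bsub>mat_space n\<^esub>"
    then have "(\<Oplus>\<^bsub>mat_space n\<^esub> v\<in>E ` {..d}. a v \<cdot>\<^sub>m v) = 0\<^sub>m n n"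
      by (simp add: V.lincomb_def matrix_vs_simps)
    also have "(\<Oplus>\<^bsub>mat_space n\<^esub> v\<in>E ` {..d}. a v \<cdot>\<^sub>m v) = (\<Oplus>\<^bsub>mat_space n\<^esub> p\<in>{..d}. a (E p) \<cdot>\<^sub>m E p)"
      using inj_on_idempotents carrier by (subst V.finsum_reindex) (auto simp: matrix_vs_simps)
    finally have *: "mat_comb n d (\<lambda>p. a (E p)) E = 0\<^sub>m n n"
      using mat_comb_eq_finsum[of d E n, OF carrier] by simp
    have "a (E p) = 0" if "p \<le> d" for p
      using mat_comb_mult_idempotent[OF that, of "\<lambda>p. a (E p)"] smult_eq_zero[OF that] carrier[OF that]
      unfolding * by auto
    then show "\<forall>v\<in>E ` {..d}. a v = \<zero>\<^bsub>class_ring\<^esub>" by (auto simp: matrix_vs_simps)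
  qed (use carrier in \<open>auto simp: matrix_vs_simps\<close>)
qed

text \<open>
  In \<open>E p = F + G\<close> with \<open>F * G = 0\<close> one has \<open>F = F * E p\<close>, a multiple of \<open>E p\<close>, and an
  idempotent multiple of \<open>E p\<close> is \<open>0\<close> or \<open>E p\<close>.
\<close>

lemma primitive_idempotent_mat_comb:
  assumes "p \<le> d"
  shows "primitive_idempotent n (range (\<lambda>a. mat_comb n d a E)) (E p)"
  unfolding primitive_idempotent_def
proof (intro conjI notI)
  show "E p \<in> range (\<lambda>a. mat_comb n d a E)"
    using mat_comb_single[where X = E, OF assms carrier[OF assms]] by (metis rangeI)
  show "E p * E p = E p" using assms orthogonal by simp
  show False if "E p = 0\<^sub>m n n" using that assms nonzero by simp
next
  assume "\<exists>F\<in>range (\<lambda>a. mat_comb n d a E). \<exists>G\<in>range (\<lambda>a. mat_comb n d a E).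
    F * F = F \<and> G * G = G \<and> F \<noteq> 0\<^sub>m n n \<and> G \<noteq> 0\<^sub>m n n \<and> F * G = 0\<^sub>m n n \<and> G * F = 0\<^sub>m n n \<and> E p = F + G"
  then obtain f G where idem: "mat_comb n d f E * mat_comb n d f E = mat_comb n d f E"
    and F0: "mat_comb n d f E \<noteq> 0\<^sub>m n n" and G0: "G \<noteq> 0\<^sub>m n n"
    and FG: "mat_comb n d f E * G = 0\<^sub>m n n" and E: "E p = mat_comb n d f E + G"
    and G: "G \<in> carrier_mat n n"
    by (auto simp del: mat_comb_index)
  let ?F = "mat_comb n d f E"
  have "?F * E p = ?F * ?F + ?F * G"
    unfolding E by (rule mult_add_distrib_mat[OF mat_comb_carrier mat_comb_carrier G])
  then have F: "?F = f p \<cdot>\<^sub>m E p"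
    using mat_comb_mult_idempotent[OF assms, of f] idem FG by simp
  have "?F * (f p \<cdot>\<^sub>m E p) = f p \<cdot>\<^sub>m (?F * E p)"
    by (rule mult_smult_distrib[OF mat_comb_carrier carrier[OF assms]])
  then have "f p \<cdot>\<^sub>m (f p \<cdot>\<^sub>m E p) = f p \<cdot>\<^sub>m E p"
    using mat_comb_mult_idempotent[OF assms, of f] idem F by simp
  then have "(f p * f p - f p) \<cdot>\<^sub>m E p = 0\<^sub>m n n"
    using carrier[OF assms] by (auto simp: mat_eq_iff algebra_simps)
  then have "f p * (f p - 1) = 0"
    using smult_eq_zero[OF assms, of "f p * f p - f p"] by (simp add: algebra_simps)
  moreover have "f p \<noteq> 0"
    using F F0 carrier[OF assms] by (auto simp: mat_eq_iff)
  ultimately have "?F = E p"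
    using F carrier[OF assms] by (auto intro!: eq_matI)
  then have "G $$ (i, j) = 0" if "i < n" "j < n" for i j
    using arg_cong[OF E, of "\<lambda>M. M $$ (i, j)"] that G by auto
  then have "G = 0\<^sub>m n n" using G by (intro eq_matI) auto
  with G0 show False by simp
qed

lemma idempotent_basisI:
  assumes "bose_mesner n d A = range (\<lambda>a. mat_comb n d a E)"
    and "E 0 = (1 / of_nat n) \<cdot>\<^sub>m all_ones n n"
  shows "idempotent_basis n d A E"
  unfolding idempotent_basis_def
  using assms primitive_idempotent_mat_comb inj_on_idempotents lin_indpt_idempotents
    span_image_eq_mat_comb[of d E n, OF carrier]
  by simp

end

text \<open>In the basis of idempotents multiplication is coefficientwise, so closure and
  commutativity of the Bose--Mesner algebra come for free; only the combinatorial axioms remain as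
  premises.\<close>

lemma (in orthogonal_idempotents) association_schemeI:
  assumes bm: "bose_mesner n d A = range (\<lambda>a. mat_comb n d a E)"
    and "\<And>i. i \<le> d \<Longrightarrow> A i \<in> carrier_mat n n \<and> elements_mat (A i) \<subseteq> {0, 1} \<and> A i \<noteq> 0\<^sub>m n n"
    and "A 0 = 1\<^sub>m n"
    and "mat_comb n d (\<lambda>_. 1) A = all_ones n n"
    and "\<And>i. i \<le> d \<Longrightarrow> transpose_mat (A i) \<in> A ` {..d}"
  shows "association_scheme n d A"
proof -
  have "(\<Oplus>\<^bsub>mat_space n\<^esub> i\<in>{..d}. A i) = mat_comb n d (\<lambda>_. 1) A"
    using assms(2) by (subst finsum_mat_space) (auto simp: mat_comb_def)
  then show ?thesis
    unfolding association_scheme_def bm using assms(2-) by (auto simp: mat_comb_mult mult.commute)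
qed

section \<open>Non-symmetric schemes of class 2 as tournaments\<close>

text \<open>The degree \<open>k\<close> is taken as a complex number, since it is compared with sums
  of complex matrix entries; this also permits halving \<open>m - 1\<close> and \<open>k - 1\<close>
  without parity arguments.\<close>

locale doubly_regular_tournament =
  fixes m :: nat and B :: "complex mat" and k :: complex
  assumes pos: "m > 0"
    and B: "B \<in> carrier_mat m m"
    and zero_one: "i < m \<Longrightarrow> j < m \<Longrightarrow> B $$ (i, j) = 0 \<or> B $$ (i, j) = 1"
    and diagonal: "i < m \<Longrightarrow> B $$ (i, i) = 0"
    and tournament: "i < m \<Longrightarrow> j < m \<Longrightarrow> i \<noteq> j \<Longrightarrow> B $$ (i, j) + B $$ (j, i) = 1"
    and k: "of_nat m = 2 * k + 1"
    and out_degree: "i < m \<Longrightarrow> (\<Sum>l<m. B $$ (i, l)) = k"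
    and in_degree: "i < m \<Longrightarrow> (\<Sum>l<m. B $$ (l, i)) = k"
    and common_out:
      "i < m \<Longrightarrow> j < m \<Longrightarrow> (\<Sum>l<m. B $$ (i, l) * B $$ (j, l)) = (if i = j then k else (k - 1) / 2)"
    and common_in:
      "i < m \<Longrightarrow> j < m \<Longrightarrow> (\<Sum>l<m. B $$ (l, i) * B $$ (l, j)) = (if i = j then k else (k - 1) / 2)"

lemma atMost_2: "{..2::nat} = {0, 1, 2}" and atMost_3: "{..3::nat} = {0, 1, 2, 3}"
  by auto

text \<open>Closure and commutativity give \<open>A 1 * A 2 = A 2 * A 1\<close> with coefficients
  \<open>c 0\<close>, \<open>c 1\<close>, \<open>c 2\<close> in the basis of the scheme. The
  diagonal of this product yields constant degrees, its symmetry yields \<open>c 1 = c 2\<close>,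
  and a row sum fixes the common value.\<close>

lemma nonsymmetric_scheme_doubly_regular_tournament:
  assumes m: "m > 0" and scheme: "association_scheme m 2 A" and nonsym: "nonsymmetric_scheme 2 A"
  shows "A 2 = transpose_mat (A 1) \<and> doubly_regular_tournament m (A 1) ((of_nat m - 1) / 2)"
proof -
  have A: "A i \<in> carrier_mat m m" "elements_mat (A i) \<subseteq> {0, 1}" "A i \<noteq> 0\<^sub>m m m" if "i \<le> 2" for i
    using scheme that by (auto simp: association_scheme_def)
  have dims [simp]: "dim_row (A i) = m" "dim_col (A i) = m" if "i \<le> 2" for i
    using A(1)[OF that] by auto
  have A0: "A 0 = 1\<^sub>m m" using scheme by (simp add: association_scheme_def)
  have "(\<Oplus>\<^bsub>mat_space m\<^esub> i\<in>{..2}. A i) = all_ones m m"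
    using scheme by (simp add: association_scheme_def)
  then have sum_J: "mat m m (\<lambda>(i, j). \<Sum>p\<le>2. A p $$ (i, j)) = all_ones m m"
    using A by (subst (asm) finsum_mat_space) auto
  have sum1: "A 0 $$ (i, j) + A 1 $$ (i, j) + A 2 $$ (i, j) = 1" if "i < m" "j < m" for i j
    using arg_cong[OF sum_J, of "\<lambda>M. M $$ (i, j)"] that
    by (simp add: all_ones_def atMost_2 add.assoc)
  have zo: "A p $$ (i, j) = 0 \<or> A p $$ (i, j) = 1" if "p \<le> 2" "i < m" "j < m" for p i j
    using elements_matI[OF A(1)[OF that(1)] that(2,3) refl] A(2)[OF that(1)] by blast
  \<comment> \<open>At position \<open>(0, 0)\<close> the matrix \<open>A 0\<close> already
    contributes the whole sum 1, so no other relation has an entry 1 there.\<close>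
  have not_one: "A p \<noteq> 1\<^sub>m m" if "p = 1 \<or> p = 2" for p
  proof
    assume "A p = 1\<^sub>m m"
    with sum1[of 0 0] zo[of 1 0 0] zo[of 2 0 0] m that show False
      by (auto simp: A0)
  qed
  have tr: "transpose_mat (A i) \<in> {A 0, A 1, A 2}" if "i \<le> 2" for i
    using scheme that by (auto simp: association_scheme_def atMost_2)
  have tr0: "transpose_mat (A i) \<noteq> A 0" if "i = 1 \<or> i = 2" for i
    using not_one[OF that] A0 by (metis transpose_one transpose_transpose)
  obtain i where i: "i \<le> 2" "transpose_mat (A i) \<noteq> A i"
    using nonsym by (auto simp: nonsymmetric_scheme_def)
  then have "i \<noteq> 0" by (metis A0 transpose_one)
  with i(1) have "i = 1 \<or> i = 2" by auto
  \<comment> \<open>The transpose of the asymmetric \<open>A i\<close> is neither \<open>A i\<close>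
    nor the identity, hence it is the other nontrivial relation.\<close>
  then have A2: "A 2 = transpose_mat (A 1)"
    using i tr[of i] tr0[of i] by (elim disjE) (auto dest: arg_cong[of _ _ transpose_mat])
  define b where "b i j = A 1 $$ (i, j)" for i j
  have A2b: "A 2 $$ (i, j) = b j i" if "i < m" "j < m" for i j
    using that by (simp add: A2 b_def)
  have b01: "b i j = 0 \<or> b i j = 1" if "i < m" "j < m" for i j
    using zo[of 1] that by (simp add: b_def)
  have bsum: "b i j + b j i = (if i = j then 0 else 1)" if "i < m" "j < m" for i j
    using sum1[OF that] A2b that by (auto simp: A0 b_def)
  have bdiag: "b i i = 0" if "i < m" for i using bsum[of i i] that by simp
  have bsq: "b i j * b i j = b i j" if "i < m" "j < m" for i j using b01[OF that] by auto

  have bm: "bose_mesner m 2 A = range (\<lambda>a. mat_comb m 2 a A)"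
    unfolding bose_mesner_def by (rule span_image_eq_mat_comb) (use A in auto)
  have inbm: "A i \<in> bose_mesner m 2 A" if "i \<le> 2" for i
    unfolding bm using mat_comb_single[where X = A, OF that A(1)[OF that]] by (metis rangeI)
  have "A 1 * A 2 \<in> bose_mesner m 2 A" and comm: "A 1 * A 2 = A 2 * A 1"
    using scheme inbm by (auto simp: association_scheme_def)
  then obtain c where c: "A 1 * A 2 = mat_comb m 2 c A" unfolding bm by auto
  have mult12: "(\<Sum>l<m. b i l * b j l) = (A 1 * A 2) $$ (i, j)" if "i < m" "j < m" for i j
    using that by (simp add: scalar_prod_def lessThan_atLeast0 A2b b_def)
  have mult21: "(\<Sum>l<m. b l i * b l j) = (A 1 * A 2) $$ (i, j)" if "i < m" "j < m" for i j
    unfolding comm using that by (simp add: scalar_prod_def lessThan_atLeast0 A2b b_def)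
  have val: "(A 1 * A 2) $$ (i, j) = (if i = j then c 0 else 0) + c 1 * b i j + c 2 * b j i"
    if "i < m" "j < m" for i j
    unfolding c using that by (simp add: atMost_2 A0 A2b) (simp add: b_def)
  \<comment> \<open>Entries are 0 or 1, so a diagonal entry of \<open>A 1 * A 2\<close>, a sum of
    squares, equals the out-degree.\<close>
  have out: "(\<Sum>l<m. b i l) = c 0" if "i < m" for i
    using mult12[OF that that] val[OF that that] bdiag[OF that] that by (simp add: bsq)
  have inn: "(\<Sum>l<m. b l i) = c 0" if "i < m" for i
    using mult21[OF that that] val[OF that that] bdiag[OF that] that by (simp add: bsq)
  define k :: complex where "k = (of_nat m - 1) / 2"
  have mk: "of_nat m = 2 * k + 1" by (simp add: k_def field_simps)
  \<comment> \<open>Every vertex other than 0 is either an out-neighbour or an in-neighbour of 0, so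
    the two equal degrees add up to \<open>m - 1\<close>.\<close>
  have c0: "c 0 = k"
  proof -
    have "c 0 + c 0 = (\<Sum>l<m. b 0 l + b l 0)" using out[of 0] inn[of 0] m by (simp add: sum.distrib)
    also have "\<dots> = (\<Sum>l<m. 1 - (if l = 0 then 1 else 0))" using m by (intro sum.cong) (auto simp: bsum)
    also have "\<dots> = of_nat m - 1" using m by (simp add: sum_subtractf)
    finally have "2 * c 0 = of_nat m - 1" by simp
    then show ?thesis unfolding k_def by (simp add: eq_divide_eq mult.commute)
  qed
  obtain x y where xy: "x < m" "y < m" "b x y = 1"
  proof -
    have "\<exists>x<m. \<exists>y<m. b x y \<noteq> 0"
      using A(3)[of 1] by (auto simp: mat_eq_iff b_def)
    with that b01 show thesis by blast
  qed
  have b_yx: "b y x = 0" "x \<noteq> y" using bsum[OF xy(1,2)] bdiag xy by (auto split: if_splits)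
  \<comment> \<open>As \<open>A 1\<close> times its transpose, the product is symmetric; along the
    arc from \<open>x\<close> to \<open>y\<close> its entries at \<open>(x, y)\<close> and
    \<open>(y, x)\<close> are \<open>c 1\<close> and \<open>c 2\<close>.\<close>
  have c12: "c 1 = c 2"
    using mult12[OF xy(1,2)] mult12[OF xy(2,1)] val[OF xy(1,2)] val[OF xy(2,1)] xy(3) b_yx
    by (simp add: mult.commute)
  \<comment> \<open>Nonvanishing of \<open>k\<close> allows its cancellation in the row count for
    \<open>c 1\<close>; a single vertex would leave no room for the arc from \<open>x\<close> to
    \<open>y\<close>.\<close>
  have k0: "k \<noteq> 0"
  proof
    assume "k = 0"
    then have "of_nat m = (of_nat 1 :: complex)" by (simp add: k_def)
    then have "m = 1" by (simp only: of_nat_eq_iff)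
    with xy b_yx show False by auto
  qed
  have val': "(A 1 * A 2) $$ (i, j) = (if i = j then k else c 1)" if "i < m" "j < m" for i j
  proof -
    have "(A 1 * A 2) $$ (i, j) = (if i = j then c 0 else 0) + c 1 * (b i j + b j i)"
      unfolding val[OF that] distrib_left c12 by (rule add.assoc)
    then show ?thesis unfolding bsum[OF that] c0 by (auto split: if_splits)
  qed
  \<comment> \<open>Row 0 of \<open>A 1 * A 2\<close> is summed twice: regularity gives
    \<open>k * k\<close>, while the known entries give \<open>k + (m - 1) * c 1\<close> with
    \<open>m - 1 = 2 * k\<close>.\<close>
  have c1: "c 1 = (k - 1) / 2"
  proof -
    have "(\<Sum>j<m. (A 1 * A 2) $$ (0, j)) = (\<Sum>j<m. \<Sum>l<m. b 0 l * b j l)"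
      using m by (intro sum.cong) (auto simp: mult12)
    also have "\<dots> = (\<Sum>l<m. b 0 l * (\<Sum>j<m. b j l))"
      by (subst sum.swap) (simp add: sum_distrib_left)
    also have "\<dots> = k * k"
      using out[of 0] m by (simp add: inn c0 sum_distrib_right[symmetric])
    finally have "k * k = (\<Sum>j<m. (A 1 * A 2) $$ (0, j))" by (rule sym)
    also have "\<dots> = (\<Sum>j<m. c 1 + (if j = 0 then k - c 1 else 0))"
      using m by (intro sum.cong) (auto simp: val'[unfolded One_nat_def] simp del: index_mult_mat)
    also have "\<dots> = of_nat m * c 1 + (k - c 1)" using m by (simp add: sum.distrib)
    also have "\<dots> = (2 * k + 1) * c 1 + (k - c 1)" by (simp add: mk)
    finally have "k * (k - 1 - 2 * c 1) = 0" by (simp add: algebra_simps)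
    with k0 have "k = 1 + 2 * c 1" by (simp only: mult_eq_0_iff) (auto simp: algebra_simps)
    then show ?thesis by simp
  qed
  have common: "(\<Sum>l<m. b i l * b j l) = (if i = j then k else (k - 1) / 2)"
    "(\<Sum>l<m. b l i * b l j) = (if i = j then k else (k - 1) / 2)" if "i < m" "j < m" for i j
    unfolding mult12[OF that] mult21[OF that] val'[OF that] c1 by simp_all
  have "doubly_regular_tournament m (A 1) k"
    by unfold_locales
      (use m A(1)[of 1] b01 bdiag bsum out[unfolded c0] inn[unfolded c0] mk common in \<open>simp_all add: b_def\<close>)
  with A2 show ?thesis by (simp add: k_def)
qed

section \<open>The extended double cover\<close>

context doubly_regular_tournament
begin

definition N :: nat where "N = 2 * (m + 1)"

definition C1 :: "complex mat" where "C1 = double_cover_mat m B (transpose_mat B)"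

abbreviation C2 :: "complex mat" where "C2 \<equiv> transpose_mat C1"

definition C3 :: "complex mat" where "C3 = all_ones N N - 1\<^sub>m N - C1 - C2"

lemma dim_B [simp]: "dim_row B = m" "dim_col B = m"
  using B by auto

lemma dim_C1 [simp]: "dim_row C1 = N" "dim_col C1 = N"
  by (simp_all add: double_cover_mat_def all_ones_def C1_def N_def)

lemma dim_C3 [simp]: "dim_row C3 = N" "dim_col C3 = N"
  by (simp_all add: C3_def)

lemma C_carrier [simp]: "C1 \<in> carrier_mat N N" "C2 \<in> carrier_mat N N" "C3 \<in> carrier_mat N N"
  by (auto intro!: carrier_matI)

text \<open>These are the blocks of sizes 1, \<open>m\<close>, \<open>m\<close>, 1. Applied to rows
  and columns, the rule reduces entrywise claims about the cover to sixteen block cases.\<close>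

lemma index_cases:
  assumes "i < N"
  obtains "i = 0" | p where "p < m" "i = Suc p" | p where "p < m" "i = Suc (m + p)" | "i = Suc (2 * m)"
proof -
  consider "i = 0" | "0 < i" "i \<le> m" | "m < i" "i \<le> 2 * m" | "i = Suc (2 * m)"
    using assms unfolding N_def by atomize_elim arith
  then show ?thesis
  proof cases
    case 2
    then show ?thesis using that(2)[of "i - 1"] by auto
  next
    case 3
    then show ?thesis using that(3)[of "i - m - 1"] by auto
  qed (use that in blast)+
qed

lemma sum_N:
  "(\<Sum>l<N. f l) = f 0 + (\<Sum>p<m. f (Suc p)) + (\<Sum>p<m. f (Suc (m + p))) + f (Suc (2 * m))"
  for f :: "nat \<Rightarrow> complex"
proof -
  have "(\<Sum>l<m + m. f (Suc l)) = (\<Sum>p<m. f (Suc p)) + (\<Sum>p<m. f (Suc (m + p)))"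
    using sum.atLeastLessThan_concat[of 0 m "m + m" "\<lambda>l. f (Suc l)"]
      sum.shift_bounds_nat_ivl[of "\<lambda>l. f (Suc l)" 0 m m]
    by (simp add: lessThan_atLeast0 add.commute)
  moreover have "N = Suc (Suc (m + m))" by (simp add: N_def)
  ultimately show ?thesis
    by (simp add: sum.lessThan_Suc_shift[of f] add_ac mult_2 del: sum.lessThan_Suc)
       (simp add: add_ac)
qed

lemma tournament_sum:
  "i < m \<Longrightarrow> j < m \<Longrightarrow> B $$ (i, j) + B $$ (j, i) = (if i = j then 0 else 1)"
  using tournament[of i j] diagonal[of i] by auto

lemma C1_index:
  "C1 $$ (0, 0) = 0"
  "q < m \<Longrightarrow> C1 $$ (0, Suc q) = 1"
  "q < m \<Longrightarrow> C1 $$ (0, Suc (m + q)) = 0"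
  "C1 $$ (0, Suc (2 * m)) = 0"
  "p < m \<Longrightarrow> C1 $$ (Suc p, 0) = 0"
  "p < m \<Longrightarrow> q < m \<Longrightarrow> C1 $$ (Suc p, Suc q) = B $$ (p, q)"
  "p < m \<Longrightarrow> q < m \<Longrightarrow> C1 $$ (Suc p, Suc (m + q)) = B $$ (q, p)"
  "p < m \<Longrightarrow> C1 $$ (Suc p, Suc (2 * m)) = 1"
  "p < m \<Longrightarrow> C1 $$ (Suc (m + p), 0) = 1"
  "p < m \<Longrightarrow> q < m \<Longrightarrow> C1 $$ (Suc (m + p), Suc q) = B $$ (q, p)"
  "p < m \<Longrightarrow> q < m \<Longrightarrow> C1 $$ (Suc (m + p), Suc (m + q)) = B $$ (p, q)"
  "p < m \<Longrightarrow> C1 $$ (Suc (m + p), Suc (2 * m)) = 0"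
  "C1 $$ (Suc (2 * m), 0) = 0"
  "q < m \<Longrightarrow> C1 $$ (Suc (2 * m), Suc q) = 0"
  "q < m \<Longrightarrow> C1 $$ (Suc (2 * m), Suc (m + q)) = 1"
  "C1 $$ (Suc (2 * m), Suc (2 * m)) = 0"
  using pos by (simp_all add: C1_def double_cover_mat_def all_ones_def)

text \<open>The first and last points are exchanged, as are the two copies of each tournament
  vertex. Among the points, the final branch is reached only by the last one.\<close>

definition antipode :: "nat \<Rightarrow> nat" where
  "antipode i = (if i = 0 then Suc (2 * m) else if i \<le> m then i + m
    else if i \<le> 2 * m then i - m else 0)"

lemma antipode_simps [simp]:
  "antipode 0 = Suc (2 * m)"
  "p < m \<Longrightarrow> antipode (Suc p) = Suc (m + p)"
  "p < m \<Longrightarrow> antipode (Suc (m + p)) = Suc p"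
  "antipode (Suc (2 * m)) = 0"
  by (auto simp: antipode_def)

lemma antipode_less: "i < N \<Longrightarrow> antipode i < N"
  by (erule index_cases) (auto simp: N_def)

lemma antipode_antipode: "i < N \<Longrightarrow> antipode (antipode i) = i"
  by (erule index_cases) auto

text \<open>In each of the four middle blocks \<open>C1 + C2\<close> equals the sum of
  \<open>B\<close> and its transpose, which is 1 off the diagonal and 0 on it. Hence
  \<open>C1 + C2\<close> misses exactly the diagonal and the antipodal pairs.\<close>

lemma C3_index:
  assumes "i < N" "j < N"
  shows "C3 $$ (i, j) = (if j = antipode i then 1 else 0)"
proof -
  have "C3 $$ (i, j) = 1 - (if i = j then 1 else 0) - (C1 $$ (i, j) + C1 $$ (j, i))"
    using assms by (simp add: all_ones_def C3_def)
  also have "\<dots> = (if j = antipode i then 1 else 0)"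
    using assms(1)
  proof (cases rule: index_cases)
    case 1
    from assms(2) show ?thesis
      by (cases rule: index_cases) (use 1 pos in \<open>auto simp: C1_index\<close>)
  next
    case (2 p)
    from assms(2) show ?thesis
      by (cases rule: index_cases)
        (use 2 in \<open>auto simp: C1_index tournament_sum\<close>)
  next
    case (3 p)
    from assms(2) show ?thesis
      by (cases rule: index_cases)
        (use 3 in \<open>auto simp: C1_index tournament_sum\<close>)
  next
    case 4
    from assms(2) show ?thesis
      by (cases rule: index_cases) (use 4 pos in \<open>auto simp: C1_index\<close>)
  qed
  finally show ?thesis .
qed

lemma C1_zero_one:
  assumes "i < N" "j < N"
  shows "C1 $$ (i, j) = 0 \<or> C1 $$ (i, j) = 1"
  using assms(1)
proof (cases rule: index_cases)
  case 1
  from assms(2) show ?thesis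
    by (cases rule: index_cases) (use 1 pos in \<open>auto simp: C1_index\<close>)
next
  case (2 p)
  from assms(2) show ?thesis
    by (cases rule: index_cases) (use 2 zero_one in \<open>auto simp: C1_index\<close>)
next
  case (3 p)
  from assms(2) show ?thesis
    by (cases rule: index_cases) (use 3 zero_one in \<open>auto simp: C1_index\<close>)
next
  case 4
  from assms(2) show ?thesis
    by (cases rule: index_cases) (use 4 pos in \<open>auto simp: C1_index\<close>)
qed

text \<open>Exchanging the outer two block rows and the inner two block rows turns \<open>C1\<close>
  into its transpose, and likewise for columns: passing to an antipode reverses arcs.\<close>

lemma C1_antipode:
  assumes "i < N" "j < N"
  shows "C1 $$ (antipode i, j) = C1 $$ (j, i)" and "C1 $$ (j, antipode i) = C1 $$ (i, j)"
proof -
  have "C1 $$ (antipode i, j) = C1 $$ (j, i) \<and> C1 $$ (j, antipode i) = C1 $$ (i, j)"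
    using assms(1)
  proof (cases rule: index_cases)
    case 1
    from assms(2) show ?thesis
      by (cases rule: index_cases) (use 1 pos in \<open>auto simp: C1_index\<close>)
  next
    case (2 p)
    from assms(2) show ?thesis
      by (cases rule: index_cases) (use 2 in \<open>auto simp: C1_index\<close>)
  next
    case (3 p)
    from assms(2) show ?thesis
      by (cases rule: index_cases) (use 3 in \<open>auto simp: C1_index\<close>)
  next
    case 4
    from assms(2) show ?thesis
      by (cases rule: index_cases) (use 4 pos in \<open>auto simp: C1_index\<close>)
  qed
  then show "C1 $$ (antipode i, j) = C1 $$ (j, i)" and "C1 $$ (j, antipode i) = C1 $$ (i, j)"
    by auto
qed

section \<open>Products of the relations of the cover\<close>

lemma mult_index:
  "X \<in> carrier_mat N N \<Longrightarrow> Y \<in> carrier_mat N N \<Longrightarrow> i < N \<Longrightarrow> j < N \<Longrightarrow>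
    (X * Y) $$ (i, j) = (\<Sum>l<N. X $$ (i, l) * Y $$ (l, j))"
  by (simp add: scalar_prod_def lessThan_atLeast0)

lemma C3_mult_index:
  assumes "X \<in> carrier_mat N N" "i < N" "j < N"
  shows "(C3 * X) $$ (i, j) = X $$ (antipode i, j)"
proof -
  have "(C3 * X) $$ (i, j) = (\<Sum>l<N. if l = antipode i then X $$ (l, j) else 0)"
      unfolding mult_index[OF C_carrier(3) assms]
    using assms by (intro sum.cong) (auto simp: C3_index)
  then show ?thesis using antipode_less[OF assms(2)] by simp
qed

lemma C3_C1: "C3 * C1 = C2"
  by (rule eq_matI) (auto simp: C3_mult_index C1_antipode simp del: index_mult_mat(1))

lemma C3_C3: "C3 * C3 = 1\<^sub>m N"
  by (rule eq_matI)
    (auto simp: C3_mult_index C3_index antipode_less antipode_antipode simp del: index_mult_mat(1))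

lemma C3_C2: "C3 * C2 = C1"
  by (rule eq_matI)
    (auto simp: C3_mult_index C1_antipode antipode_less simp del: index_mult_mat(1))

lemma C3_transpose: "transpose_mat C3 = C3"
  by (rule eq_matI) (auto simp: C3_def all_ones_def)

lemma C1_C3: "C1 * C3 = C2"
  using arg_cong[OF C3_C2, of transpose_mat] by (simp add: transpose_mult[of _ N N _ N] C3_transpose)

lemma C2_C3: "C2 * C3 = C1"
  using arg_cong[OF C3_C1, of transpose_mat] by (simp add: transpose_mult[of _ N N _ N] C3_transpose)

text \<open>Replacing \<open>B $$ (l, q)\<close> by 1 minus \<open>B $$ (q, l)\<close> for
  \<open>l \<noteq> q\<close> turns the count of two-step walks into an out-degree minus a number of
  common out-neighbours.\<close>

lemma paths_same_colour:
  assumes "p < m" "q < m"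
  shows "(\<Sum>l<m. B $$ (p, l) * B $$ (l, q)) = k - B $$ (p, q) - (if p = q then k else (k - 1) / 2)"
proof -
  have "(\<Sum>l<m. B $$ (p, l) * B $$ (l, q))
      = (\<Sum>l<m. B $$ (p, l) - (if l = q then B $$ (p, l) else 0) - B $$ (p, l) * B $$ (q, l))"
  proof (rule sum.cong)
    fix l assume "l \<in> {..<m}"
    then have *: "B $$ (l, q) = (if l = q then 0 else 1) - B $$ (q, l)"
      using tournament_sum[of l q] assms by (simp add: algebra_simps)
    then show "B $$ (p, l) * B $$ (l, q)
        = B $$ (p, l) - (if l = q then B $$ (p, l) else 0) - B $$ (p, l) * B $$ (q, l)"
      by (subst *) (simp add: algebra_simps)
  qed simp
  also have "\<dots> = k - B $$ (p, q) - (if p = q then k else (k - 1) / 2)"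
    using assms by (simp add: sum_subtractf out_degree common_out)
  finally show ?thesis .
qed

text \<open>These sums are the entries of \<open>C1 * C2\<close> between the two copies of the
  tournament. The two orders of summands correspond to the two off-diagonal middle blocks, so that
  both match by rewriting.\<close>

lemma paths_both_ways:
  assumes "p < m" "q < m"
  shows "(\<Sum>l<m. B $$ (p, l) * B $$ (l, q)) + (\<Sum>l<m. B $$ (l, p) * B $$ (q, l))
      = (if p = q then 0 else k)"
    and "(\<Sum>l<m. B $$ (l, p) * B $$ (q, l)) + (\<Sum>l<m. B $$ (p, l) * B $$ (l, q))
      = (if p = q then 0 else k)"
proof -
  have "(\<Sum>l<m. B $$ (l, p) * B $$ (q, l)) = (\<Sum>l<m. B $$ (q, l) * B $$ (l, p))"
    by (simp only: mult.commute)
  also have "\<dots> = k - B $$ (q, p) - (if p = q then k else (k - 1) / 2)"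
    using paths_same_colour[OF assms(2,1)] by auto
  finally have "(\<Sum>l<m. B $$ (p, l) * B $$ (l, q)) + (\<Sum>l<m. B $$ (l, p) * B $$ (q, l))
      = 2 * k - (B $$ (p, q) + B $$ (q, p)) - 2 * (if p = q then k else (k - 1) / 2)"
    using paths_same_colour[OF assms] by simp
  then show *: "(\<Sum>l<m. B $$ (p, l) * B $$ (l, q)) + (\<Sum>l<m. B $$ (l, p) * B $$ (q, l))
      = (if p = q then 0 else k)"
    unfolding tournament_sum[OF assms] by (cases "p = q") (simp_all add: diff_divide_distrib)
  show "(\<Sum>l<m. B $$ (l, p) * B $$ (q, l)) + (\<Sum>l<m. B $$ (p, l) * B $$ (l, q))
      = (if p = q then 0 else k)"
    by (rule trans[OF add.commute *])
qed

text \<open>In a diagonal middle block, for instance, common out-neighbours, common in-neighbours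
  and one outer point add up to \<open>2 * k + 1 = m\<close> on the diagonal and to
  \<open>(k - 1) + 1 = k\<close> off it.\<close>

lemma C1_C2_index:
  assumes "i < N" "j < N"
  shows "(\<Sum>l<N. C1 $$ (i, l) * C1 $$ (j, l))
    = (if i = j then of_nat m else 0) + k * (C1 $$ (i, j) + C1 $$ (j, i))"
proof -
  note [simp] = C1_index sum_N tournament_sum out_degree in_degree common_out common_in
    paths_both_ways k
  show ?thesis
    using assms(1)
  proof (cases rule: index_cases)
    case 1
    from assms(2) show ?thesis
      by (cases rule: index_cases) (use 1 pos in \<open>auto\<close>)
  next
    case (2 p)
    from assms(2) show ?thesis
      by (cases rule: index_cases) (use 2 in \<open>auto simp: diff_divide_distrib\<close>)
  next
    case (3 p)
    from assms(2) show ?thesis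
      by (cases rule: index_cases) (use 3 in \<open>auto simp: diff_divide_distrib\<close>)
  next
    case 4
    from assms(2) show ?thesis
      by (cases rule: index_cases) (use 4 pos in \<open>auto\<close>)
  qed
qed

lemma C1_C2: "C1 * C2 = of_nat m \<cdot>\<^sub>m 1\<^sub>m N + k \<cdot>\<^sub>m (C1 + C2)"
proof (rule eq_matI)
  fix i j
  assume "i < dim_row (of_nat m \<cdot>\<^sub>m 1\<^sub>m N + k \<cdot>\<^sub>m (C1 + C2))"
    and "j < dim_col (of_nat m \<cdot>\<^sub>m 1\<^sub>m N + k \<cdot>\<^sub>m (C1 + C2))"
  then have ij: "i < N" "j < N" by auto
  then have "(C1 * C2) $$ (i, j) = (\<Sum>l<N. C1 $$ (i, l) * C1 $$ (j, l))"
    unfolding mult_index[OF C_carrier(1,2) ij] by (intro sum.cong) auto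
  with ij show "(C1 * C2) $$ (i, j) = (of_nat m \<cdot>\<^sub>m 1\<^sub>m N + k \<cdot>\<^sub>m (C1 + C2)) $$ (i, j)"
    by (simp add: C1_C2_index del: index_mult_mat)
qed auto

end

section \<open>Idempotents and eigenmatrix of the cover\<close>

lemma le_3_cases: "p \<le> 3 \<longleftrightarrow> p = 0 \<or> p = 1 \<or> p = 2 \<or> p = (3::nat)"
  by auto

lemma all_le_3: "(\<forall>p\<le>3. R p) \<longleftrightarrow> R 0 \<and> R 1 \<and> R 2 \<and> R (3::nat)"
  by (auto simp: le_3_cases)

lemma range_mat_comb_eq:
  assumes "\<And>p. p \<le> d \<Longrightarrow> Y p = mat_comb n d (Q p) X" and "\<And>p. p \<le> d \<Longrightarrow> X p = mat_comb n d (R p) Y"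
  shows "range (\<lambda>a. mat_comb n d a X) = range (\<lambda>a. mat_comb n d a Y)"
proof -
  have "mat_comb n d a Y = mat_comb n d (\<lambda>q. \<Sum>p\<le>d. a p * Q p q) X" for a
    using mat_comb_cong[of d a a Y "\<lambda>p. mat_comb n d (Q p) X" n] assms(1) mat_comb_mat_comb by simp
  moreover have "mat_comb n d a X = mat_comb n d (\<lambda>q. \<Sum>p\<le>d. a p * R p q) Y" for a
    using mat_comb_cong[of d a a X "\<lambda>p. mat_comb n d (R p) Y" n] assms(2) mat_comb_mat_comb by simp
  ultimately show ?thesis by blast
qed

context doubly_regular_tournament
begin

lemma C1_C2_C3: "(C1 * C2) * C3 = of_nat m \<cdot>\<^sub>m C3 + k \<cdot>\<^sub>m (C1 + C2)"
proof -
  have "(C1 * C2) * C3 = (of_nat m \<cdot>\<^sub>m 1\<^sub>m N) * C3 + (k \<cdot>\<^sub>m (C1 + C2)) * C3"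
    unfolding C1_C2 by (rule add_mult_distrib_mat[of _ N N]) auto
  also have "(of_nat m \<cdot>\<^sub>m 1\<^sub>m N) * C3 = of_nat m \<cdot>\<^sub>m C3"
    by (subst mult_smult_assoc_mat[of _ N N]) (auto simp: left_mult_one_mat[of _ N N])
  also have "(k \<cdot>\<^sub>m (C1 + C2)) * C3 = k \<cdot>\<^sub>m ((C1 + C2) * C3)"
    by (rule mult_smult_assoc_mat[of _ N N]) auto
  also have "(C1 + C2) * C3 = C1 + C2"
    by (subst add_mult_distrib_mat[of _ N N]) (auto simp: C1_C3 C2_C3 intro!: comm_add_mat)
  finally show ?thesis .
qed

text \<open>The remaining products reduce to \<open>C1 * C2\<close> by writing
  \<open>C1 = C2 * C3\<close> or \<open>C2 = C1 * C3\<close> and reassociating.\<close>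

lemma C1_C1: "C1 * C1 = of_nat m \<cdot>\<^sub>m C3 + k \<cdot>\<^sub>m (C1 + C2)"
  using assoc_mult_mat[of C1 N N C2 N C3 N] by (simp add: C2_C3 C1_C2_C3)

lemma C2_C1: "C2 * C1 = of_nat m \<cdot>\<^sub>m 1\<^sub>m N + k \<cdot>\<^sub>m (C1 + C2)"
  using assoc_mult_mat[of C1 N N C3 N C1 N] by (simp add: C1_C3 C3_C1 C1_C2)

lemma C2_C2: "C2 * C2 = of_nat m \<cdot>\<^sub>m C3 + k \<cdot>\<^sub>m (C1 + C2)"
  using assoc_mult_mat[of C2 N N C1 N C3 N] by (simp add: C1_C3 C2_C1 C1_C2_C3 flip: C1_C2)

definition C :: "nat \<Rightarrow> complex mat" where "C = (!) [1\<^sub>m N, C1, C2, C3]"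

lemma C_simps [simp]: "C 0 = 1\<^sub>m N" "C (Suc 0) = C1" "C 2 = C2" "C 3 = C3"
  by (simp_all add: C_def)

lemma C_carrier_mat: "p \<le> 3 \<Longrightarrow> C p \<in> carrier_mat N N"
  by (auto simp: le_3_cases)

text \<open>Coordinates of a product in the basis \<open>C 0\<close>, ..., \<open>C 3\<close>; the
  factors \<open>of_nat m\<close> and \<open>k\<close> are the structure constants of the
  multiplication table.\<close>

definition conv :: "(nat \<Rightarrow> complex) \<Rightarrow> (nat \<Rightarrow> complex) \<Rightarrow> nat \<Rightarrow> complex" where
  "conv a b = (!)
    [a 0 * b 0 + of_nat m * (a 1 * b 2 + a 2 * b 1) + a 3 * b 3,
     a 0 * b 1 + a 1 * b 0 + k * ((a 1 + a 2) * (b 1 + b 2)) + a 2 * b 3 + a 3 * b 2,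
     a 0 * b 2 + a 2 * b 0 + k * ((a 1 + a 2) * (b 1 + b 2)) + a 1 * b 3 + a 3 * b 1,
     a 0 * b 3 + a 3 * b 0 + of_nat m * (a 1 * b 1 + a 2 * b 2)]"

lemma mat_comb_C_mult: "mat_comb N 3 a C * mat_comb N 3 b C = mat_comb N 3 (conv a b) C"
proof (rule eq_matI)
  fix i j assume "i < dim_row (mat_comb N 3 (conv a b) C)" "j < dim_col (mat_comb N 3 (conv a b) C)"
  then have ij: "i < N" "j < N" by auto
  show "(mat_comb N 3 a C * mat_comb N 3 b C) $$ (i, j) = mat_comb N 3 (conv a b) C $$ (i, j)"
    using ij
    by (simp add: mat_comb_mult_index[OF C_carrier_mat] atMost_3 conv_def
        left_mult_one_mat[of _ N N] right_mult_one_mat[of _ N N]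
        C1_C1 C1_C2 C1_C3 C2_C1 C2_C2 C2_C3 C3_C1 C3_C2 C3_C3 del: index_mult_mat index_one_mat)
      (simp add: algebra_simps)
qed auto

lemma C_zero_one_nonzero:
  assumes "p \<le> 3"
  shows "C p \<in> carrier_mat N N \<and> elements_mat (C p) \<subseteq> {0, 1} \<and> C p \<noteq> 0\<^sub>m N N"
proof (intro conjI)
  have "C p $$ (i, j) = 0 \<or> C p $$ (i, j) = 1" if "i < N" "j < N" for i j
    using assms that C1_zero_one[OF that] C1_zero_one[OF that(2,1)] by (auto simp: le_3_cases C3_index)
  then show "elements_mat (C p) \<subseteq> {0, 1}"
    using C_carrier_mat[OF assms] by (fastforce simp: elements_mat_def)
  have N: "0 < N" "Suc 0 < N" "Suc (2 * m) < N" by (auto simp: N_def pos)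
  \<comment> \<open>The four positions are witnesses for the identity, \<open>C1\<close>,
    \<open>C2\<close> and \<open>C3\<close>, in this order.\<close>
  have "C p $$ (0, 0) \<noteq> 0 \<or> C p $$ (0, Suc 0) \<noteq> 0 \<or>
      C p $$ (Suc 0, 0) \<noteq> 0 \<or> C p $$ (0, Suc (2 * m)) \<noteq> 0"
    using assms N pos C1_index(2)[of 0] by (auto simp: le_3_cases C3_index)
  then have "\<exists>i<N. \<exists>j<N. C p $$ (i, j) \<noteq> 0"
    using N by blast
  then show "C p \<noteq> 0\<^sub>m N N" by auto
qed (rule C_carrier_mat[OF assms])

lemma mat_comb_C_one: "mat_comb N 3 (\<lambda>_. 1) C = all_ones N N"
  by (rule eq_matI) (auto simp: atMost_3 C3_def all_ones_def)

lemma transpose_C: "p \<le> 3 \<Longrightarrow> transpose_mat (C p) \<in> C ` {..3}"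
  by (auto simp: le_3_cases atMost_3 C3_transpose)

end

section \<open>Explicit idempotents from the inverse of the eigenmatrix\<close>

locale double_cover_eigenvalue = doubly_regular_tournament +
  fixes s :: complex
  assumes s: "s * s = - of_nat m"
begin

definition P :: "complex mat" where
  "P = mat_of_rows_list 4
     [[1, of_nat m, of_nat m,  1],
      [1,        s,       -s, -1],
      [1,       -s,        s, -1],
      [1,       -1,       -1,  1]]"

definition c :: complex where "c = 1 / of_nat N"

definition t :: complex where "t = s / (4 * of_nat m)"

text \<open>The transposed inverse of \<open>P\<close>: row \<open>p\<close> holds the coordinates
  of \<open>E p\<close> in the basis \<open>C\<close>.\<close>

definition Q :: "nat \<Rightarrow> nat \<Rightarrow> complex" where
  "Q p q = [[c, c, c, c],
     [1 / 4, - t, t, - 1 / 4],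
     [1 / 4, t, - t, - 1 / 4],
     [of_nat m * c, - c, - c, of_nat m * c]] ! p ! q"

definition E :: "nat \<Rightarrow> complex mat" where "E p = mat_comb N 3 (Q p) C"

lemma of_nat_m_nonzero: "of_nat m \<noteq> (0 :: complex)"
  using pos by simp

lemma c_nonzero: "c \<noteq> 0"
  by (simp add: c_def N_def del: of_nat_Suc of_nat_add)

text \<open>Since \<open>N = 4 * k + 4\<close>, this pins down \<open>c\<close> by a polynomial
  equation. With \<open>m\<close> replaced by \<open>2 * k + 1\<close>, the identities for
  \<open>Q\<close> then become ideal membership problems.\<close>

lemma c: "4 * k * c + 4 * c = 1"
proof -
  have "4 * k * c + 4 * c = of_nat N * c" by (simp add: N_def k algebra_simps)
  also have "\<dots> = 1" using c_nonzero by (auto simp: c_def)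
  finally show ?thesis .
qed

lemma conv_Q:
  assumes "p \<le> 3" "q \<le> 3" "r \<le> 3"
  shows "conv (Q p) (Q q) r = (if p = q then Q p r else 0)"
proof -
  \<comment> \<open>This is \<open>16 * m * t * t = s * s / m\<close> rewritten through
    \<open>s * s = - m\<close>.\<close>
  have t: "16 * (2 * k + 1) * t * t = - 1"
    using s of_nat_m_nonzero unfolding t_def k[symmetric] by (simp add: field_simps)
  have "\<forall>p\<le>3. \<forall>q\<le>3. \<forall>r\<le>3. conv (Q p) (Q q) r = (if p = q then Q p r else 0)"
    unfolding all_le_3 conv_def Q_def k
    by (intro conjI; simp; (simp add: field_simps)?; insert c t; Groebner_Basis.algebra)
  then show ?thesis using assms by blast
qed

lemma P_Q:
  assumes "q \<le> 3" "r \<le> 3"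
  shows "(\<Sum>p\<le>3. P $$ (p, q) * Q p r) = (if r = q then 1 else 0)"
proof -
  have st: "4 * s * t = - 1"
    using s of_nat_m_nonzero unfolding t_def by (simp add: field_simps)
  have "\<forall>q\<le>3. \<forall>r\<le>3. (\<Sum>p\<le>3. P $$ (p, q) * Q p r) = (if r = q then 1 else 0)"
    unfolding all_le_3 atMost_3 P_def mat_of_rows_list_def Q_def k
    by (intro conjI; simp; (simp add: field_simps)?; insert c st; Groebner_Basis.algebra)
  then show ?thesis using assms by blast
qed

sublocale E: orthogonal_idempotents N 3 E
proof
  show "E p \<in> carrier_mat N N" for p by (simp add: E_def)
  show "E p * E q = (if p = q then E p else 0\<^sub>m N N)" if "p \<le> 3" "q \<le> 3" for p q
  proof -
    have "E p * E q = mat_comb N 3 (\<lambda>r. if p = q then Q p r else 0) C"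
      unfolding E_def mat_comb_C_mult by (rule mat_comb_cong) (simp_all add: conv_Q that)
    then show ?thesis by (auto simp: E_def intro!: eq_matI)
  qed
  show "E p \<noteq> 0\<^sub>m N N" if "p \<le> 3" for p
  proof
    assume "E p = 0\<^sub>m N N"
    moreover have "0 < N" by (simp add: N_def)
    \<comment> \<open>Only the identity among the \<open>C q\<close> has a nonzero entry at
      \<open>(0, 0)\<close>, so that entry of \<open>E p\<close> is its first coordinate.\<close>
    moreover from this have "E p $$ (0, 0) = Q p 0"
      by (simp add: E_def atMost_3 C1_index C3_index)
    ultimately have "Q p 0 = 0" by simp
    with that pos show False
      unfolding le_3_cases by (elim disjE) (simp_all add: Q_def c_nonzero)
  qed
qed

text \<open>This inverts the change of basis that defines \<open>E\<close>, by \<open>P_Q\<close>.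
  It yields both the eigenmatrix and the equality of the two spans.\<close>

lemma C_eq_mat_comb_E:
  assumes "q \<le> 3"
  shows "C q = mat_comb N 3 (\<lambda>p. P $$ (p, q)) E"
proof -
  have "mat_comb N 3 (\<lambda>p. P $$ (p, q)) E = mat_comb N 3 (\<lambda>r. \<Sum>p\<le>3. P $$ (p, q) * Q p r) C"
    unfolding E_def by (rule mat_comb_mat_comb)
  also have "\<dots> = mat_comb N 3 (\<lambda>r. if r = q then 1 else 0) C"
    by (rule mat_comb_cong) (simp_all add: P_Q assms)
  also have "\<dots> = C q"
    by (rule mat_comb_single[where X = C, OF assms C_carrier_mat[OF assms]])
  finally show ?thesis by simp
qed

lemma bose_mesner_C: "bose_mesner N 3 C = range (\<lambda>a. mat_comb N 3 a E)"
proof -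
  have "bose_mesner N 3 C = range (\<lambda>a. mat_comb N 3 a C)"
    unfolding bose_mesner_def by (rule span_image_eq_mat_comb) (rule C_carrier_mat)
  also have "\<dots> = range (\<lambda>a. mat_comb N 3 a E)"
    by (rule range_mat_comb_eq[OF E_def C_eq_mat_comb_E])
  finally show ?thesis .
qed

lemma association_scheme_C: "association_scheme N 3 C"
  by (rule E.association_schemeI[OF bose_mesner_C C_zero_one_nonzero _ mat_comb_C_one transpose_C]) auto

lemma idempotent_basis_E: "idempotent_basis N 3 C E"
proof (rule E.idempotent_basisI[OF bose_mesner_C])
  have "E 0 = mat_comb N 3 (\<lambda>_. 1 / of_nat N) C"
    unfolding E_def by (rule mat_comb_cong) (auto simp: le_3_cases Q_def c_def)
  also have "\<dots> = (1 / of_nat N) \<cdot>\<^sub>m mat_comb N 3 (\<lambda>_. 1) C"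
    by (rule eq_matI) (auto simp: sum_distrib_left sum_divide_distrib)
  finally show "E 0 = (1 / of_nat N) \<cdot>\<^sub>m all_ones N N"
    by (simp add: mat_comb_C_one)
qed

lemma first_eigenmatrix_P: "first_eigenmatrix N 3 C E P"
  unfolding first_eigenmatrix_def
  using C_eq_mat_comb_E mat_comb_eq_finsum[of 3 E N, OF E.carrier]
  by (auto simp: P_def mat_of_rows_list_def)

end

theorem theorem4p1:
  fixes m :: nat and A :: "nat \<Rightarrow> complex mat"
  assumes "m > 0"
    and "association_scheme m 2 A"
    and "nonsymmetric_scheme 2 A"
  defines "s \<equiv> \<i> * complex_of_real (sqrt (real m))"
  shows "association_scheme (2 * (m + 1)) 3 (extended_double_cover m A) \<and>
    (\<exists>E. idempotent_basis (2 * (m + 1)) 3 (extended_double_cover m A) E \<and>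
         first_eigenmatrix (2 * (m + 1)) 3 (extended_double_cover m A) E
           (mat_of_rows_list 4
              [[1, of_nat m, of_nat m,  1],
               [1,        s,       -s, -1],
               [1,       -s,        s, -1],
               [1,       -1,       -1,  1]]))"
proof -
  have A2: "A 2 = transpose_mat (A 1)"
    and tournament: "doubly_regular_tournament m (A 1) ((of_nat m - 1) / 2)"
    using nonsymmetric_scheme_doubly_regular_tournament[OF assms(1-3)] by auto
  interpret doubly_regular_tournament m "A 1" "(of_nat m - 1) / 2" by (rule tournament)
  have "s * s = (\<i> * \<i>) * complex_of_real (sqrt (real m) * sqrt (real m))"
    unfolding s_def of_real_mult by (simp only: mult_ac)
  then interpret double_cover_eigenvalue m "A 1" "(of_nat m - 1) / 2" s
    by unfold_locales simp
  have "extended_double_cover m A = C"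
    unfolding extended_double_cover_def Let_def C_def C3_def C1_def N_def A2 by (rule refl)
  then show ?thesis
    using association_scheme_C idempotent_basis_E first_eigenmatrix_P
    unfolding P_def N_def by auto
qed

end
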